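(* There exists a regular Baire almost $P$-space $X$ with a closed subspace $C \subset X$ that is not weakly Volterra.
   Context: A subset of a topological space is a $G_\delta$ set if it is a countable intersection of open sets. A topological space is an almost $P$-space if every non-empty $G_\delta$ subset of it has non-empty interior. A space is Baire if every countable intersection of dense open subsets is dense. A space $Y$ is weakly Volterra if for every pair $G, H$ of dense $G_\delta$ subsets of $Y$, the set $G \cap H$ is non-empty. Subsets of $X$ carry the subspace topology. All spaces, including the subspace in question, are understood to be non-empty; regular spaces are understood to be Hausdorff. *)

theory Defs
  imports "HOL-Analysis.Analysis"
begin

definition dense_subset :: "'a topology \<Rightarrow> 'a set \<Rightarrow> bool" where
  "dense_subset X S \<longleftrightarrow> S \<subseteq> topspace X \<and> X closure_of S = topspace X"

definition almost_P_space :: "'a topology \<Rightarrow> bool" where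
  "almost_P_space X \<longleftrightarrow>
     (\<forall>S. gdelta_in X S \<and> S \<noteq> {} \<longrightarrow> X interior_of S \<noteq> {})"

(* Intersecting with topspace X only matters for the empty family, since the Inter of the
   empty family is UNIV rather than the whole space. *)
definition Baire_space :: "'a topology \<Rightarrow> bool" where
  "Baire_space X \<longleftrightarrow>
     (\<forall>\<U>. countable \<U> \<and> (\<forall>U\<in>\<U>. openin X U \<and> dense_subset X U)
        \<longrightarrow> dense_subset X (topspace X \<inter> \<Inter>\<U>))"

definition weakly_Volterra :: "'a topology \<Rightarrow> bool" where
  "weakly_Volterra Y \<longleftrightarrow>
     (\<forall>G H. gdelta_in Y G \<and> dense_subset Y G \<and> gdelta_in Y H \<and> dense_subset Y H
        \<longrightarrow> G \<inter> H \<noteq> {})"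

end

theory Submission
  imports Defs
begin

text \<open>
  The space is a countable space \<open>D\<close> that is not weakly Volterra, surrounded by isolated points so
  that no point of \<open>D\<close> can be singled out by countably many open sets. Think of
  \<open>D \<times> (T \<union> {\<infinity>})\<close> with \<open>T\<close> uncountable: all points \<open>(d, t)\<close> are isolated, and a basic
  neighbourhood of \<open>(d, \<infinity>)\<close> is \<open>U \<times> {\<infinity>}\<close> together with \<open>U \<times> T\<close> minus a countable set, where
  \<open>U\<close> is a neighbourhood of \<open>d\<close>. The copy of \<open>D\<close> at infinity is a closed subspace.

  A \<open>G\<^sub>\<delta>\<close> set through \<open>(d, \<infinity>)\<close> omits only countably many points of the fibre over \<open>d\<close>, hence
  contains an isolated point; this gives the almost \<open>P\<close> property
  (\<open>almost_P_space_fibre_topology\<close>). The isolated points are thus dense, and every dense open set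
  contains all of them, so the space is Baire (\<open>Baire_space_fibre_topology\<close>). Regularity is inherited
  from the base, because the cocountable condition concerns only isolated points
  (\<open>regular_space_fibre_topology\<close>).

  For \<open>D\<close> one takes a countable set of reals that is the disjoint union of two dense sets, namely
  \<open>\<rat> \<union> (t + \<rat>)\<close> with \<open>t\<close> irrational. Every subset of a countable \<open>T\<^sub>1\<close> space is a \<open>G\<^sub>\<delta>\<close>, so the
  two halves are disjoint dense \<open>G\<^sub>\<delta>\<close> sets. To realise all this on the real line, the fibres are the
  half-open unit intervals, indexed by \<open>D\<close>, and their left end points are the points at infinity.
\<close>

section \<open>A topology with cocountable fibres\<close>

text \<open>
  Here \<open>p\<close> is the projection to the base and \<open>K\<close> is the set of points at infinity. Stating the
  topology through an arbitrary map, rather than on a product, lets it live on the real line.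
\<close>

definition fibre_open :: "'a set \<Rightarrow> ('a \<Rightarrow> 'b::topological_space) \<Rightarrow> 'a set \<Rightarrow> bool" where
  "fibre_open K p V \<longleftrightarrow>
     (\<forall>k\<in>V \<inter> K. \<exists>U. open U \<and> p k \<in> U \<and> p -` U \<inter> K \<subseteq> V \<and> countable (p -` U - V))"

definition fibre_topology :: "'a set \<Rightarrow> ('a \<Rightarrow> 'b::topological_space) \<Rightarrow> 'a topology" where
  "fibre_topology K p = topology (fibre_open K p)"

lemma istopology_fibre_open: "istopology (fibre_open K p)"
  unfolding istopology_def
proof (intro conjI allI impI)
  fix S T assume S: "fibre_open K p S" and T: "fibre_open K p T"
  show "fibre_open K p (S \<inter> T)"
    unfolding fibre_open_def
  proof
    fix k assume k: "k \<in> S \<inter> T \<inter> K"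
    obtain U where U: "open U" "p k \<in> U" "p -` U \<inter> K \<subseteq> S" "countable (p -` U - S)"
      using S k unfolding fibre_open_def by blast
    obtain W where W: "open W" "p k \<in> W" "p -` W \<inter> K \<subseteq> T" "countable (p -` W - T)"
      using T k unfolding fibre_open_def by blast
    have "countable (p -` (U \<inter> W) - S \<inter> T)"
      by (rule countable_subset[of _ "(p -` U - S) \<union> (p -` W - T)"]) (use U W in auto)
    then show "\<exists>U. open U \<and> p k \<in> U \<and> p -` U \<inter> K \<subseteq> S \<inter> T \<and> countable (p -` U - S \<inter> T)"
      using U W by (intro exI[of _ "U \<inter> W"]) auto
  qed
next
  fix \<V> assume \<V>: "\<forall>V\<in>\<V>. fibre_open K p V"
  show "fibre_open K p (\<Union>\<V>)"
    unfolding fibre_open_def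
  proof
    fix k assume "k \<in> \<Union>\<V> \<inter> K"
    then obtain V where V: "V \<in> \<V>" "k \<in> V \<inter> K" by blast
    then obtain U where U: "open U" "p k \<in> U" "p -` U \<inter> K \<subseteq> V" "countable (p -` U - V)"
      using \<V> unfolding fibre_open_def by blast
    have "countable (p -` U - \<Union>\<V>)"
      by (rule countable_subset[OF _ U(4)]) (use V in auto)
    then show "\<exists>U. open U \<and> p k \<in> U \<and> p -` U \<inter> K \<subseteq> \<Union>\<V> \<and> countable (p -` U - \<Union>\<V>)"
      using U V by (intro exI[of _ U]) auto
  qed
qed

lemma openin_fibre_topology [simp]: "openin (fibre_topology K p) V \<longleftrightarrow> fibre_open K p V"
  unfolding fibre_topology_def by (simp add: topology_inverse' istopology_fibre_open)

lemma topspace_fibre_topology [simp]: "topspace (fibre_topology K p) = UNIV"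
proof -
  have "fibre_open K p UNIV"
    unfolding fibre_open_def by (auto intro: exI[of _ UNIV])
  then show ?thesis
    using openin_subset[of "fibre_topology K p" UNIV] by auto
qed

lemma closedin_fibre_topology: "closedin (fibre_topology K p) E \<longleftrightarrow> fibre_open K p (- E)"
  unfolding closedin_def Compl_eq_Diff_UNIV by simp

lemma fibre_open_vimage: "open U \<Longrightarrow> fibre_open K p (p -` U)"
  unfolding fibre_open_def by (intro ballI exI[of _ U]) simp

lemma fibre_open_isolated: "V \<inter> K = {} \<Longrightarrow> fibre_open K p V"
  unfolding fibre_open_def by blast

lemma closedin_fibre_topology_infinity: "closedin (fibre_topology K p) K"
  by (simp add: closedin_fibre_topology fibre_open_isolated)

lemma closedin_fibre_topology_singleton:
  fixes p :: "'a \<Rightarrow> 'b::t1_space"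
  assumes "inj_on p K"
  shows "closedin (fibre_topology K p) {x}"
proof -
  have "fibre_open K p (- {x})"
    unfolding fibre_open_def
  proof
    fix k assume k: "k \<in> - {x} \<inter> K"
    show "\<exists>U. open U \<and> p k \<in> U \<and> p -` U \<inter> K \<subseteq> - {x} \<and> countable (p -` U - - {x})"
    proof (cases "x \<in> K")
      case True
      then have "p k \<noteq> p x" using assms k by (auto dest: inj_onD)
      then show ?thesis by (intro exI[of _ "- {p x}"]) auto
    next
      case False
      then show ?thesis by (intro exI[of _ UNIV]) auto
    qed
  qed
  then show ?thesis by (simp add: closedin_fibre_topology)
qed

text \<open>
  Let \<open>E\<close> be closed and \<open>k\<close> a point at infinity outside \<open>E\<close>. Some base neighbourhood \<open>U\<close> of \<open>p k\<close>
  has no point of \<open>E\<close> at infinity above it. If \<open>W'\<close> is an open set containing the complement of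
  \<open>U\<close>, then all points of \<open>E\<close> at infinity lie above \<open>W'\<close>; the remaining points of \<open>E\<close> are isolated, so
  adding them to the preimage of \<open>W'\<close> keeps it open.
\<close>

lemma regular_space_fibre_topology:
  fixes p :: "'a \<Rightarrow> 'b::t3_space"
  assumes "inj_on p K"
  shows "regular_space (fibre_topology K p)"
  unfolding regular_space_def
proof (intro allI impI, elim conjE)
  fix E x
  assume E: "closedin (fibre_topology K p) E" and x: "x \<in> topspace (fibre_topology K p) - E"
  have opE: "fibre_open K p (- E)"
    using E by (simp add: closedin_fibre_topology)
  show "\<exists>U V. openin (fibre_topology K p) U \<and> openin (fibre_topology K p) V \<and>
          x \<in> U \<and> E \<subseteq> V \<and> disjnt U V"
  proof (cases "x \<in> K")
    case False
    have "fibre_open K p (- {x})"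
      using closedin_fibre_topology_singleton[OF assms, of x]
      by (simp add: closedin_fibre_topology)
    then show ?thesis
      using False x by (intro exI[of _ "{x}"] exI[of _ "- {x}"])
        (auto simp: fibre_open_isolated disjnt_def)
  next
    case True
    then obtain U where U: "open U" "p x \<in> U" "p -` U \<inter> K \<subseteq> - E"
      using opE x unfolding fibre_open_def by blast
    obtain W W' where W: "open W" "open W'" "p x \<in> W" "- U \<subseteq> W'" "W \<inter> W' = {}"
      using t3_space[of "- U" "p x"] U by auto
    have "fibre_open K p (- E \<inter> p -` W)"
      using openin_Int[of "fibre_topology K p" "- E" "p -` W"] opE W by (simp add: fibre_open_vimage)
    moreover have "fibre_open K p (E \<union> p -` W')"
      unfolding fibre_open_def
    proof
      fix k assume "k \<in> (E \<union> p -` W') \<inter> K"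
      then have "p k \<in> W'" using U W by auto
      moreover have "p -` W' - (E \<union> p -` W') = {}" by blast
      then have "countable (p -` W' - (E \<union> p -` W'))" by (simp only: countable_empty)
      ultimately show "\<exists>U. open U \<and> p k \<in> U \<and> p -` U \<inter> K \<subseteq> E \<union> p -` W' \<and>
                   countable (p -` U - (E \<union> p -` W'))"
        using W(2) by blast
    qed
    ultimately show ?thesis
      using x W by (intro exI[of _ "- E \<inter> p -` W"] exI[of _ "E \<union> p -` W'"]) (auto simp: disjnt_def)
  qed
qed

lemma Hausdorff_space_fibre_topology:
  fixes p :: "'a \<Rightarrow> 'b::t3_space"
  assumes "inj_on p K"
  shows "Hausdorff_space (fibre_topology K p)"
proof (rule regular_t1_imp_Hausdorff_space)
  show "regular_space (fibre_topology K p)" by (rule regular_space_fibre_topology[OF assms])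
  show "t1_space (fibre_topology K p)"
    by (simp add: t1_space_closedin_singleton closedin_fibre_topology_singleton[OF assms])
qed

section \<open>Isolated points and countable intersections\<close>

text \<open>
  Each of the countably many open sets omits only countably many points of the fibre through a
  point of the intersection at infinity, hence so do all of them together. The fibre is uncountable
  and meets \<open>K\<close> only once, so another of its points remains in the intersection.
\<close>

lemma gdelta_in_fibre_topology_meets_isolated:
  assumes inj: "inj_on p K"
    and fib: "\<And>k. k \<in> K \<Longrightarrow> uncountable (p -` {p k})"
    and S: "gdelta_in (fibre_topology K p) S" and ne: "S \<noteq> {}"
  shows "S - K \<noteq> {}"
proof
  assume "S - K = {}"
  then obtain k where k: "k \<in> K" "k \<in> S" using ne by blast
  obtain \<V> where \<V>: "countable \<V>" "\<And>V. V \<in> \<V> \<Longrightarrow> fibre_open K p V" "S = \<Inter>\<V>"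
  proof -
    have "(countable intersection_of openin (fibre_topology K p)) S"
      using S by (simp only: gdelta_in_alt)
    then obtain \<V> where "countable \<V>" "\<V> \<subseteq> Collect (openin (fibre_topology K p))" "\<Inter>\<V> = S"
      unfolding intersection_of_def by (elim exE conjE) (rule that)
    then show ?thesis
      by (intro that[of \<V>]) auto
  qed
  have "countable (p -` {p k} - V)" if V: "V \<in> \<V>" for V
  proof -
    have "k \<in> V \<inter> K" using k V \<V>(3) by blast
    then obtain U where U: "p k \<in> U" "countable (p -` U - V)"
      using \<V>(2)[OF V] unfolding fibre_open_def by blast
    show ?thesis by (rule countable_subset[OF _ U(2)]) (use U(1) in auto)
  qed
  then have "countable ((\<Union>V\<in>\<V>. p -` {p k} - V) \<union> {k})"
    using \<V>(1) by (intro countable_Un countable_UN) simp_all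
  moreover have "p -` {p k} \<subseteq> (\<Union>V\<in>\<V>. p -` {p k} - V) \<union> {k}"
  proof
    fix x assume x: "x \<in> p -` {p k}"
    show "x \<in> (\<Union>V\<in>\<V>. p -` {p k} - V) \<union> {k}"
    proof (cases "x \<in> S")
      case True
      then have "x \<in> K" using \<open>S - K = {}\<close> by blast
      then show ?thesis using x k inj by (auto dest: inj_onD)
    next
      case False
      then show ?thesis using x \<V>(3) by auto
    qed
  qed
  ultimately show False using fib[OF k(1)] by (meson countable_subset)
qed

lemma almost_P_space_fibre_topology:
  assumes "inj_on p K" and "\<And>k. k \<in> K \<Longrightarrow> uncountable (p -` {p k})"
  shows "almost_P_space (fibre_topology K p)"
  unfolding almost_P_space_def
proof (intro allI impI, elim conjE)
  fix S assume "gdelta_in (fibre_topology K p) S" "S \<noteq> {}"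
  then obtain x where "x \<in> S" "x \<notin> K"
    using gdelta_in_fibre_topology_meets_isolated[OF assms] by blast
  then have "{x} \<subseteq> fibre_topology K p interior_of S"
    by (intro interior_of_maximal) (auto simp: fibre_open_isolated)
  then show "fibre_topology K p interior_of S \<noteq> {}" by blast
qed

lemma dense_subset_iff_meets_open:
  "dense_subset X S \<longleftrightarrow> S \<subseteq> topspace X \<and> (\<forall>V. openin X V \<and> V \<noteq> {} \<longrightarrow> S \<inter> V \<noteq> {})"
  unfolding dense_subset_def using dense_intersects_open[of X S] by auto

lemma Baire_space_fibre_topology:
  assumes "inj_on p K" and "\<And>k. k \<in> K \<Longrightarrow> uncountable (p -` {p k})"
  shows "Baire_space (fibre_topology K p)"
  unfolding Baire_space_def
proof (intro allI impI, elim conjE)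
  fix \<U>
  assume \<U>: "\<forall>U\<in>\<U>. openin (fibre_topology K p) U \<and> dense_subset (fibre_topology K p) U"
  have iso: "- K \<subseteq> \<Inter>\<U>"
  proof (intro subsetI InterI)
    fix x U assume "x \<in> - K" "U \<in> \<U>"
    moreover from this have "openin (fibre_topology K p) {x}"
      by (simp add: fibre_open_isolated)
    ultimately have "U \<inter> {x} \<noteq> {}"
      using \<U> unfolding dense_subset_iff_meets_open by blast
    then show "x \<in> U" by blast
  qed
  have avoid: "V - K \<noteq> {}" if "openin (fibre_topology K p) V" "V \<noteq> {}" for V
    using gdelta_in_fibre_topology_meets_isolated[OF assms open_imp_gdelta_in] that by blast
  have "(topspace (fibre_topology K p) \<inter> \<Inter>\<U>) \<inter> V \<noteq> {}"
    if V: "openin (fibre_topology K p) V" "V \<noteq> {}" for V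
  proof -
    obtain x where "x \<in> V" "x \<in> - K" using avoid[OF V] by blast
    moreover have "x \<in> \<Inter>\<U>" using iso \<open>x \<in> - K\<close> by (rule subsetD)
    ultimately have "x \<in> (topspace (fibre_topology K p) \<inter> \<Inter>\<U>) \<inter> V"
      unfolding topspace_fibre_topology by (intro IntI UNIV_I)
    then show ?thesis by (metis empty_iff)
  qed
  then show "dense_subset (fibre_topology K p) (topspace (fibre_topology K p) \<inter> \<Inter>\<U>)"
    unfolding dense_subset_iff_meets_open by (intro conjI Int_lower1) metis
qed

section \<open>The closed subspace at infinity\<close>

text \<open>The points outside \<open>G\<close> can be removed one at a time, each by an open set.\<close>

lemma gdelta_in_countable_t1_space:
  assumes "t1_space X" and "countable (topspace X)" and "G \<subseteq> topspace X"
  shows "gdelta_in X G"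
proof -
  have "gdelta_in X (topspace X \<inter> \<Inter> ((\<lambda>x. topspace X - {x}) ` (topspace X - G)))"
  proof (cases "topspace X - G = {}")
    case True
    then show ?thesis by (simp add: open_imp_gdelta_in)
  next
    case False
    have "gdelta_in X (topspace X - {x})" if "x \<in> topspace X" for x
      using assms(1) that
      by (intro open_imp_gdelta_in) (simp add: t1_space_closedin_singleton openin_diff)
    then show ?thesis
      using False assms(2) by (intro gdelta_in_Int gdelta_in_Inter) (auto simp: open_imp_gdelta_in)
  qed
  moreover have "topspace X \<inter> \<Inter> ((\<lambda>x. topspace X - {x}) ` (topspace X - G)) = G"
    using assms(3) by auto
  ultimately show ?thesis by simp
qed

lemma dense_subset_fibre_topology_infinity:
  assumes "G \<subseteq> K" and dense: "closure (p ` G) = UNIV"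
  shows "dense_subset (subtopology (fibre_topology K p) K) G"
  unfolding dense_subset_iff_meets_open
proof (intro conjI allI impI, use assms(1) in simp, elim conjE)
  fix V assume "openin (subtopology (fibre_topology K p) K) V" "V \<noteq> {}"
  then obtain T k where T: "fibre_open K p T" "V = T \<inter> K" "k \<in> T \<inter> K"
    by (auto simp: openin_subtopology)
  then obtain U where U: "open U" "p k \<in> U" "p -` U \<inter> K \<subseteq> T"
    unfolding fibre_open_def by blast
  then have "U \<inter> p ` G \<noteq> {}"
    using dense open_Int_closure_eq_empty[of U "p ` G"] by auto
  then show "G \<inter> V \<noteq> {}" using U T assms(1) by auto
qed

lemma not_weakly_Volterra_fibre_topology_infinity:
  fixes p :: "'a \<Rightarrow> 'b::t3_space"
  assumes "inj_on p K" and "countable K" and "G \<subseteq> K" and "H \<subseteq> K" and "G \<inter> H = {}"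
    and "closure (p ` G) = UNIV" and "closure (p ` H) = UNIV"
  shows "\<not> weakly_Volterra (subtopology (fibre_topology K p) K)"
proof -
  have "t1_space (subtopology (fibre_topology K p) K)"
    by (simp add: t1_space_subtopology Hausdorff_imp_t1_space Hausdorff_space_fibre_topology[OF assms(1)])
  then have "gdelta_in (subtopology (fibre_topology K p) K) A" if "A \<subseteq> K" for A
    using that assms(2) by (intro gdelta_in_countable_t1_space) auto
  then show ?thesis
    unfolding weakly_Volterra_def using assms dense_subset_fibre_topology_infinity by metis
qed

section \<open>Realisation on the real line\<close>

lemma closure_translated_rationals: "closure ((+) (t::real) ` \<rat>) = UNIV"
  by (simp add: closure_translation Rats_closure_real surj_plus)

theorem mainTheorem2:
  shows "\<exists>(X :: real topology) C.
           topspace X \<noteq> {} \<and> regular_space X \<and> Hausdorff_space X \<and>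
           Baire_space X \<and> almost_P_space X \<and>
           closedin X C \<and> C \<noteq> {} \<and> \<not> weakly_Volterra (subtopology X C)"
proof -
  obtain t :: real where t: "t \<notin> \<rat>"
    using countable_rat uncountable_UNIV_real by (metis UNIV_eq_I)
  define D where "D = \<rat> \<union> (+) t ` \<rat>"
  have "countable D" "infinite D"
    unfolding D_def using countable_rat Rats_infinite by auto
  define g where "g = from_nat_into D \<circ> int_encode"
  have g: "bij_betw g UNIV D"
    unfolding g_def using bij_int_encode bij_betw_from_nat_into[OF \<open>countable D\<close> \<open>infinite D\<close>]
    by (rule bij_betw_trans)
  define p :: "real \<Rightarrow> real" where "p = (\<lambda>x. g \<lfloor>x\<rfloor>)"
  have inj: "inj_on p \<int>"
    using g unfolding p_def by (auto simp: inj_on_def bij_betw_def elim!: Ints_cases)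
  have fib: "uncountable (p -` {p k})" if "k \<in> \<int>" for k
  proof -
    have "{k..<k + 1} \<subseteq> p -` {p k}"
    proof
      fix x assume "x \<in> {k..<k + 1}"
      then have "\<lfloor>x\<rfloor> = \<lfloor>k\<rfloor>" using that by (auto simp: floor_eq_iff elim!: Ints_cases)
      then show "x \<in> p -` {p k}" by (simp add: p_def)
    qed
    moreover have "uncountable {k..<k + 1}" by (simp add: uncountable_half_open_interval_1)
    ultimately show ?thesis by (meson countable_subset)
  qed
  have img: "p ` (\<int> \<inter> p -` A) = A" if "A \<subseteq> D" for A
  proof -
    have "a \<in> p ` (\<int> \<inter> p -` A)" if "a \<in> A" for a
    proof -
      obtain n where "a = g n" using g \<open>a \<in> A\<close> \<open>A \<subseteq> D\<close> unfolding bij_betw_def by blast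
      then have "a = p (of_int n)" by (simp add: p_def)
      then show ?thesis using \<open>a \<in> A\<close> by auto
    qed
    then show ?thesis by auto
  qed
  have disj: "\<rat> \<inter> (+) t ` \<rat> = {}"
    using t Rats_diff by fastforce
  have "\<not> weakly_Volterra (subtopology (fibre_topology \<int> p) \<int>)"
  proof (rule not_weakly_Volterra_fibre_topology_infinity[OF inj])
    show "\<int> \<inter> p -` \<rat> \<inter> (\<int> \<inter> p -` ((+) t ` \<rat>)) = {}" using disj by auto
    show "closure (p ` (\<int> \<inter> p -` \<rat>)) = UNIV"
      using img[of \<rat>] by (simp add: D_def Rats_closure_real)
    show "closure (p ` (\<int> \<inter> p -` ((+) t ` \<rat>))) = UNIV"
      using img[of "(+) t ` \<rat>"] by (simp add: D_def closure_translated_rationals)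
  qed (auto simp: countable_int)
  then show ?thesis
    using regular_space_fibre_topology[OF inj] Hausdorff_space_fibre_topology[OF inj]
      Baire_space_fibre_topology[OF inj fib] almost_P_space_fibre_topology[OF inj fib]
      closedin_fibre_topology_infinity[of \<int> p]
    by (intro exI[of _ "fibre_topology \<int> p"] exI[of _ \<int>]) auto
qed

end
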